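(* Let $\boldsymbol m,\boldsymbol l,k$ be consistent parameters and write $$u_0(\boldsymbol m,\boldsymbol l,k)=\sum_{i=0}^{l_r}(-1)^i\,c_i(\boldsymbol m,\boldsymbol l,k)\,x^{l_r-i}.$$ Then $$c_i(\boldsymbol m,\boldsymbol l,k)=\binom{l_r}{i}\prod_{j=0}^{i-1}\prod_{s=1}^r\frac{\sum_{t=r-s+1}^rm_t-l_r+s+j}{\sum_{t=r-s+1}^rm_t-l_r+s+j+1+l_{r-s}-l_{r-s+1}},\qquad i=0,\dots,l_r.$$
   Context: Fix $r\ge1$ and put $l_0=k$, $l_{r+1}=0$. Parameters $\boldsymbol m=(m_1,\dots,m_r),\boldsymbol l=(l_1,\dots,l_r),k$ are consistent if all $m_i,l_i,k$ are non-negative integers, $k\ge l_1\ge\dots\ge l_r\ge0$ and $l_s-l_{s+1}\le m_s$ for $s=1,\dots,r$. Put $e_i^\vee=\sum_{s=r+1-i}^rm_s-l_{r-i+1}+l_{r-i}+i$, $i=0,\dots,r$ (so $e_0^\vee=l_r$). For consistent parameters $U(\boldsymbol m,\boldsymbol l,k)$ is the unique $(r+1)$-dimensional complex vector space of polynomials in $x$ such that the set of degrees of its non-zero elements is $\{e_0^\vee<\dots<e_r^\vee\}$, the set of orders of vanishing at $x=0$ of its non-zero elements is $\{i+\sum_{s=r+1-i}^rm_s:i=0,\dots,r\}$, and the set of orders of vanishing at $x=1$ is $\{0,1,\dots,r-1,r+k\}$ (existence and uniqueness are known). $u_0(\boldsymbol m,\boldsymbol l,k)$ is the unique monic polynomial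 of degree $l_r$ in $U(\boldsymbol m,\boldsymbol l,k)$. *)

theory Defs
  imports Complex_Main "HOL-Computational_Algebra.Polynomial"
begin

interpretation poly_vs: vector_space "smult :: complex \<Rightarrow> complex poly \<Rightarrow> complex poly"
  by unfold_locales (simp_all add: smult_add_right smult_add_left)

text \<open>
  The tuples \<open>(m\<^sub>1, \<dots>, m\<^sub>r)\<close> and \<open>(l\<^sub>1, \<dots>, l\<^sub>r)\<close> are functions on \<open>nat\<close> of which only the values
  at \<open>1, \<dots>, r\<close> matter; \<open>lx r l k\<close> is \<open>l\<close> extended by \<open>l\<^sub>0 = k\<close> and \<open>l\<^sub>r\<^sub>+\<^sub>1 = 0\<close>.
\<close>

definition lx :: "nat \<Rightarrow> (nat \<Rightarrow> nat) \<Rightarrow> nat \<Rightarrow> nat \<Rightarrow> nat" where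
  "lx r l k s = (if s = 0 then k else if s \<le> r then l s else 0)"

definition consistent :: "nat \<Rightarrow> (nat \<Rightarrow> nat) \<Rightarrow> (nat \<Rightarrow> nat) \<Rightarrow> nat \<Rightarrow> bool" where
  "consistent r m l k \<longleftrightarrow>
     (\<forall>s<r. lx r l k (s + 1) \<le> lx r l k s) \<and>
     (\<forall>s\<in>{1..r}. int (lx r l k s) - int (lx r l k (s + 1)) \<le> int (m s))"

definition exponent0 :: "nat \<Rightarrow> (nat \<Rightarrow> nat) \<Rightarrow> nat \<Rightarrow> nat" where
  "exponent0 r m i = i + (\<Sum>s=r+1-i..r. m s)"

definition dual_exponent :: "nat \<Rightarrow> (nat \<Rightarrow> nat) \<Rightarrow> (nat \<Rightarrow> nat) \<Rightarrow> nat \<Rightarrow> nat \<Rightarrow> int" where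
  "dual_exponent r m l k i =
     (\<Sum>s=r+1-i..r. int (m s)) - int (lx r l k (r - i + 1)) + int (lx r l k (r - i)) + int i"

text \<open>
  Since \<open>r + 1 > 0\<close>, the condition on \<open>poly_vs.dim\<close> also forces finite dimension: the dimension of
  an infinite-dimensional space is \<open>0\<close> by convention.
\<close>

definition is_U :: "nat \<Rightarrow> (nat \<Rightarrow> nat) \<Rightarrow> (nat \<Rightarrow> nat) \<Rightarrow> nat \<Rightarrow> complex poly set \<Rightarrow> bool" where
  "is_U r m l k V \<longleftrightarrow>
     poly_vs.subspace V \<and> poly_vs.dim V = r + 1 \<and>
     {int (degree p) | p. p \<in> V \<and> p \<noteq> 0} = {dual_exponent r m l k i | i. i \<le> r} \<and>
     {order 0 p | p. p \<in> V \<and> p \<noteq> 0} = {exponent0 r m i | i. i \<le> r} \<and>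
     {order 1 p | p. p \<in> V \<and> p \<noteq> 0} = {..<r} \<union> {r + k}"

definition U :: "nat \<Rightarrow> (nat \<Rightarrow> nat) \<Rightarrow> (nat \<Rightarrow> nat) \<Rightarrow> nat \<Rightarrow> complex poly set" where
  "U r m l k = (THE V. is_U r m l k V)"

definition u0 :: "nat \<Rightarrow> (nat \<Rightarrow> nat) \<Rightarrow> (nat \<Rightarrow> nat) \<Rightarrow> nat \<Rightarrow> complex poly" where
  "u0 r m l k = (THE u. u \<in> U r m l k \<and> degree u = lx r l k r \<and> lead_coeff u = 1)"

text \<open>The normalisation \<open>u0 = (\<Sum>i\<le>l\<^sub>r. (-1)\<^sup>i c\<^sub>i x\<^bsup>l\<^sub>r - i\<^esup>)\<close>, meaningful for \<open>i \<le> l\<^sub>r\<close>.\<close>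

definition u0_coeff :: "nat \<Rightarrow> (nat \<Rightarrow> nat) \<Rightarrow> (nat \<Rightarrow> nat) \<Rightarrow> nat \<Rightarrow> nat \<Rightarrow> complex" where
  "u0_coeff r m l k i = (-1) ^ i * coeff (u0 r m l k) (lx r l k r - i)"

end

theory Submission
  imports Defs
begin

text \<open>
  Write \<open>a\<^sub>i\<close> for the orders at \<open>0\<close> and \<open>d\<^sub>i\<close> for the degrees in
  \<open>U\<close>. Consistency of the parameters says that they interlace: \<open>a\<^sub>0 \<le> d\<^sub>0 <
  a\<^sub>1 \<le> d\<^sub>1 < \<dots> < a\<^sub>r \<le> d\<^sub>r\<close>, and \<open>\<Sum>i\<le>r. d\<^sub>i -
  a\<^sub>i = k\<close>. So a space with these degrees and orders has a basis \<open>p\<^sub>0, \<dots>,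
  p\<^sub>r\<close> in which only the monomials \<open>x\<^sup>n\<close> with \<open>n \<in> [a\<^sub>i,
  d\<^sub>i]\<close> occur in \<open>p\<^sub>i\<close> (\<open>adapted_element\<close>,
  \<open>subset_span_adapted\<close>), and all its elements have exponents in the set \<open>S\<close> of \<open>r +
  k + 1\<close> integers that these intervals cover.

  The key fact is that vanishing at \<open>1\<close> to order \<open>\<nu>\<close> means \<open>\<Sum>n. g\<^sub>n
  q(n) = 0\<close> for all polynomials \<open>q\<close> of degree below \<open>\<nu>\<close>
  (\<open>moment_multiple\<close>). The space contains an element \<open>g\<close> of order \<open>r + k = |S| -
  1\<close> at \<open>1\<close>. Its coefficients are annihilated by all polynomials of degree below \<open>|S| -
  1\<close> on \<open>S\<close>, hence they are proportional to \<open>1 / (\<Prod>m\<in>S-{n}. n - m)\<close>, as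
  for a divided difference (\<open>coeff_times_node_weight_const\<close>). The basis elements are, up to factors,
  the parts of this one polynomial on the intervals. This gives uniqueness of \<open>U\<close>
  (\<open>block_space_unique\<close>) together with explicit coefficients.

  For existence, the parts with these coefficients satisfy \<open>g\<^sub>n\<^sub>+\<^sub>1 P(n + 1) = g\<^sub>n
  Q(n)\<close> with \<open>P(x) = \<Prod>i. (x - a\<^sub>i)\<close> and \<open>Q(x) = \<Prod>i. (x -
  d\<^sub>i)\<close>, a hypergeometric equation. In terms of moments it forces every order at \<open>1\<close> that
  is at least \<open>r\<close> to be \<open>r + k\<close> (\<open>order_1_block_space\<close>), and counting
  dimensions shows that \<open>0, \<dots>, r - 1\<close> and \<open>r + k\<close> all occur
  (\<open>orders_1_block_space\<close>).

  Finally \<open>u\<^sub>0\<close> is the part on \<open>[a\<^sub>0, d\<^sub>0] = [0, l\<^sub>r]\<close>, made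
  monic, and iterating the recurrence downwards from \<open>x\<^bsup>l\<^sub>r\<^esup>\<close> gives the product
  formula (\<open>lowest_coeff_formula\<close>).
\<close>

section \<open>Moments of the coefficient sequence and vanishing at 1\<close>

text \<open>
  The moment is \<open>q(x d/dx) g\<close> evaluated at \<open>x = 1\<close>, because \<open>x d/dx\<close>
  multiplies \<open>x\<^sup>n\<close> by \<open>n\<close>.
\<close>

definition moment :: "complex poly \<Rightarrow> complex poly \<Rightarrow> complex" where
  "moment g q = (\<Sum>n\<le>degree g. coeff g n * poly q (of_nat n))"

lemma moment_bound:
  assumes "degree g \<le> N"
  shows "moment g q = (\<Sum>n\<le>N. coeff g n * poly q (of_nat n))"
  unfolding moment_def
  by (rule sum.mono_neutral_left) (use assms in \<open>auto simp: coeff_eq_0\<close>)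

text \<open>
  Multiplication by \<open>x\<close> shifts the coefficients by one place, so multiplication by \<open>x - 1\<close>
  is adjoint to the forward difference acting on \<open>q\<close>.
\<close>

lemma moment_mult_linear:
  "moment ([:-1, 1:] * h) q = moment h (q \<circ>\<^sub>p [:1, 1:] - q)"
proof -
  define N where "N = degree h"
  have "degree ([:-1, 1:] * h) \<le> Suc N"
    using degree_mult_le[of "[:-1, 1:]" h] by (simp add: N_def)
  hence "moment ([:-1, 1:] * h) q = (\<Sum>n\<le>Suc N. coeff ([:-1, 1:] * h) n * poly q (of_nat n))"
    by (rule moment_bound)
  also have "\<dots> = (\<Sum>n\<le>Suc N. coeff (pCons 0 h) n * poly q (of_nat n))
                  - (\<Sum>n\<le>Suc N. coeff h n * poly q (of_nat n))"
    by (simp add: sum_subtractf [symmetric] algebra_simps del: sum.atMost_Suc)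
  also have "(\<Sum>n\<le>Suc N. coeff (pCons 0 h) n * poly q (of_nat n))
      = (\<Sum>n\<le>N. coeff h n * poly q (of_nat (Suc n)))"
    by (subst sum.atMost_Suc_shift) simp
  also have "(\<Sum>n\<le>Suc N. coeff h n * poly q (of_nat n)) = (\<Sum>n\<le>N. coeff h n * poly q (of_nat n))"
    by (simp add: N_def coeff_eq_0)
  finally show ?thesis
    by (simp add: moment_def N_def poly_pcompose sum_subtractf [symmetric] algebra_simps)
qed

lemma coeff_shift_top:
  fixes q :: "complex poly"
  assumes "degree q \<le> n"
  shows "coeff (q \<circ>\<^sub>p [:1, 1:]) n = coeff q n"
proof (cases "degree q = n")
  case True
  thus ?thesis
    using lead_coeff_comp[of "[:1,1:]" q] by (simp add: degree_pcompose)
next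
  case False
  thus ?thesis using assms by (simp add: coeff_eq_0 degree_pcompose)
qed

text \<open>
  The forward difference acts on top coefficients like the derivative. The induction on \<open>q\<close> uses
  \<open>\<Delta>(c + x q) = x \<Delta>q + q(x + 1)\<close>.
\<close>

lemma difference_top:
  fixes q :: "complex poly"
  assumes "degree q \<le> Suc n"
  shows "degree (q \<circ>\<^sub>p [:1, 1:] - q) \<le> n"
    and "coeff (q \<circ>\<^sub>p [:1, 1:] - q) n = of_nat (Suc n) * coeff q (Suc n)"
proof -
  have "degree (q \<circ>\<^sub>p [:1, 1:] - q) \<le> n \<and>
        coeff (q \<circ>\<^sub>p [:1, 1:] - q) n = of_nat (Suc n) * coeff q (Suc n)"
    using assms
  proof (induction q arbitrary: n)
    case 0
    then show ?case by simp
  next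
    case (pCons c q)
    have dq: "degree q \<le> n"
      using pCons.prems by (cases "q = 0") auto
    have eq: "pCons c q \<circ>\<^sub>p [:1, 1:] - pCons c q
        = pCons 0 (q \<circ>\<^sub>p [:1, 1:] - q) + q \<circ>\<^sub>p [:1, 1:]"
      by (simp add: pcompose_pCons)
    have ds: "degree (q \<circ>\<^sub>p [:1, 1:]) \<le> n"
      using dq by (simp add: degree_pcompose)
    show ?case
    proof (cases n)
      case 0
      with dq obtain e where "q = [:e:]" by (metis degree_eq_zeroE le_zero_eq)
      thus ?thesis using 0 by (simp add: pcompose_pCons)
    next
      case (Suc n')
      have IH: "degree (q \<circ>\<^sub>p [:1, 1:] - q) \<le> n'"
        "coeff (q \<circ>\<^sub>p [:1, 1:] - q) n' = of_nat (Suc n') * coeff q (Suc n')"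
        using pCons.IH[of n'] dq Suc by auto
      have "degree (pCons 0 (q \<circ>\<^sub>p [:1, 1:] - q)) \<le> n"
        using IH(1) Suc by (meson Suc_le_mono degree_pCons_le order_trans)
      hence "degree (pCons c q \<circ>\<^sub>p [:1, 1:] - pCons c q) \<le> n"
        unfolding eq by (intro degree_add_le ds)
      moreover have "coeff (pCons c q \<circ>\<^sub>p [:1, 1:] - pCons c q) n
          = of_nat (Suc n) * coeff (pCons c q) (Suc n)"
        unfolding eq using IH(2) Suc coeff_shift_top[OF dq]
        by (simp del: coeff_diff add: algebra_simps)
      ultimately show ?thesis by blast
    qed
  qed
  thus "degree (q \<circ>\<^sub>p [:1, 1:] - q) \<le> n"
    "coeff (q \<circ>\<^sub>p [:1, 1:] - q) n = of_nat (Suc n) * coeff q (Suc n)" by blast+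
qed

text \<open>
  The moments of degree below the order of vanishing at \<open>1\<close> are all zero, and the first non-zero moment
  sees only the top coefficient of \<open>q\<close>: each factor \<open>x - 1\<close> moves over as a difference,
  and \<open>\<nu>\<close> differences turn \<open>q\<close> into the constant \<open>\<nu>! coeff q \<nu>\<close>.
\<close>

lemma moment_multiple:
  assumes "degree q \<le> \<nu>"
  shows "moment ([:-1, 1:] ^ \<nu> * h) q = fact \<nu> * coeff q \<nu> * poly h 1"
  using assms
proof (induction \<nu> arbitrary: q)
  case 0
  then obtain c where "q = [:c:]" by (metis degree_eq_zeroE le_zero_eq)
  thus ?case by (simp add: moment_def poly_altdef sum_distrib_left mult.commute)
next
  case (Suc \<nu>)
  note D = difference_top[OF Suc.prems]
  have "moment ([:-1, 1:] ^ Suc \<nu> * h) q = moment ([:-1, 1:] ^ \<nu> * h) (q \<circ>\<^sub>p [:1, 1:] - q)"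
    unfolding power_Suc mult.assoc by (rule moment_mult_linear)
  also have "\<dots> = fact \<nu> * coeff (q \<circ>\<^sub>p [:1, 1:] - q) \<nu> * poly h 1"
    by (rule Suc.IH) (rule D(1))
  finally show ?case by (simp only: D(2)) (simp add: algebra_simps)
qed

section \<open>Orders of vanishing in spaces of polynomials\<close>

lemma order_1_factor:
  fixes g :: "complex poly"
  assumes "g \<noteq> 0"
  obtains h where "g = [:-1, 1:] ^ order 1 g * h" "poly h 1 \<noteq> 0"
  using order_decomp[OF assms, of 1] by (auto simp: poly_eq_0_iff_dvd)

lemma order_0_coeff:
  fixes g :: "complex poly"
  assumes "g \<noteq> 0"
  shows "coeff g (order 0 g) \<noteq> 0" "n < order 0 g \<Longrightarrow> coeff g n = 0"
proof -
  have *: "\<And>n. n \<le> order 0 g \<longleftrightarrow> (\<forall>k<n. coeff g k = 0)"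
    using monom_1_dvd_iff[OF assms] monom_1_dvd_iff'[of _ g] by auto
  show "n < order 0 g \<Longrightarrow> coeff g n = 0" using * by blast
  show "coeff g (order 0 g) \<noteq> 0"
    using *[of "Suc (order 0 g)"] *[of "order 0 g"] by (auto simp: less_Suc_eq)
qed

text \<open>
  The filtration by order of vanishing has one-dimensional graded pieces: equal orders can be raised by subtracting
  the right multiple.
\<close>

lemma order_cancel:
  fixes p q :: "complex poly"
  assumes "p \<noteq> 0" "q \<noteq> 0" "order z p = order z q"
  obtains c where "p - smult c q = 0 \<or> order z p < order z (p - smult c q)"
proof -
  define e where "e = order z p"
  obtain f where f: "p = [:-z, 1:] ^ e * f" "poly f z \<noteq> 0"
    using order_decomp[OF assms(1), of z] by (auto simp: poly_eq_0_iff_dvd e_def)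
  obtain h where h: "q = [:-z, 1:] ^ e * h" "poly h z \<noteq> 0"
    using order_decomp[OF assms(2), of z] assms(3) by (auto simp: poly_eq_0_iff_dvd e_def)
  define c where "c = poly f z / poly h z"
  have "poly (f - smult c h) z = 0" using h by (simp add: c_def)
  then obtain s where "f - smult c h = [:-z, 1:] * s"
    unfolding poly_eq_0_iff_dvd by (rule dvdE)
  hence "p - smult c q = [:-z, 1:] ^ Suc e * s"
    unfolding f(1) h(1) power_Suc2 mult.assoc by (metis mult_smult_right right_diff_distrib)
  hence "[:-z, 1:] ^ Suc e dvd p - smult c q" by simp
  hence "p - smult c q = 0 \<or> e < order z (p - smult c q)"
    by (metis order_divides Suc_le_eq)
  thus ?thesis using that e_def by blast
qed

text \<open>
  One element for each order that occurs is enough to span: an element outside the span and of maximal order could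
  be moved to a higher order by subtracting a multiple of the chosen element of that order, and it would stay
  outside.
\<close>

lemma dim_le_card_orders:
  assumes V: "poly_vs.subspace V" and fin: "finite {order z p | p. p \<in> V \<and> p \<noteq> 0}"
  shows "poly_vs.dim V \<le> card {order z p | p. p \<in> V \<and> p \<noteq> 0}"
proof -
  define E where "E = {order z p | p. p \<in> V \<and> p \<noteq> 0}"
  have "\<forall>e\<in>E. \<exists>q. q \<in> V \<and> q \<noteq> 0 \<and> order z q = e" by (auto simp: E_def)
  then obtain q where q: "\<And>e. e \<in> E \<Longrightarrow> q e \<in> V \<and> q e \<noteq> 0 \<and> order z (q e) = e" by metis
  have "V \<subseteq> poly_vs.span (q ` E)"
  proof (rule ccontr)
    assume not_sub: "\<not> ?thesis"
    define B where "B = V - poly_vs.span (q ` E)"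
    have "B \<noteq> {}" using not_sub by (auto simp: B_def)
    have B0: "0 \<notin> B" by (simp add: B_def poly_vs.span_zero)
    have sub: "order z ` B \<subseteq> E" using B0 by (auto simp: B_def E_def)
    hence finB: "finite (order z ` B)" using fin E_def finite_subset by blast
    have "Max (order z ` B) \<in> order z ` B" using finB \<open>B \<noteq> {}\<close> by (intro Max_in) auto
    then obtain y where y: "y \<in> B" "order z y = Max (order z ` B)" by force
    have "order z y \<in> E" using sub y by blast
    note qy = q[OF this]
    obtain c where c: "y - smult c (q (order z y)) = 0 \<or>
        order z y < order z (y - smult c (q (order z y)))"
      using order_cancel[of y "q (order z y)" z] qy B0 y by metis
    have "smult c (q (order z y)) \<in> poly_vs.span (q ` E)"
      using \<open>order z y \<in> E\<close> by (intro poly_vs.span_scale poly_vs.span_base) auto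
    hence "y - smult c (q (order z y)) \<notin> poly_vs.span (q ` E)"
      using y(1) poly_vs.span_add[of "y - smult c (q (order z y))" _ "smult c (q (order z y))"]
      by (auto simp: B_def)
    hence "y - smult c (q (order z y)) \<in> B"
      using y(1) qy V by (auto simp: B_def intro: poly_vs.subspace_diff poly_vs.subspace_scale)
    moreover from this have "order z y < order z (y - smult c (q (order z y)))"
      using c B0 by auto
    ultimately show False using y(2) finB by (metis Max_ge imageI leD)
  qed
  hence "poly_vs.dim V \<le> card (q ` E)"
    using fin by (intro poly_vs.dim_le_card) (auto simp: E_def)
  also have "\<dots> \<le> card E" using fin by (intro card_image_le) (simp add: E_def)
  finally show ?thesis by (simp add: E_def)
qed

lemma span_image_sum:
  assumes "finite I"
  shows "g \<in> poly_vs.span (p ` I) \<longleftrightarrow> (\<exists>\<alpha>. g = (\<Sum>i\<in>I. smult (\<alpha> i) (p i)))"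
proof
  assume "g \<in> poly_vs.span (p ` I)"
  thus "\<exists>\<alpha>. g = (\<Sum>i\<in>I. smult (\<alpha> i) (p i))"
  proof (induction rule: poly_vs.span_induct_alt)
    case base
    show ?case by (rule exI[of _ "\<lambda>_. 0"]) simp
  next
    case (step c x y)
    then obtain \<alpha> i where *: "y = (\<Sum>i\<in>I. smult (\<alpha> i) (p i))" "i \<in> I" "x = p i" by blast
    have "smult c x + y = (\<Sum>j\<in>I. smult (\<alpha> j + (if j = i then c else 0)) (p j))"
      using * assms by (simp add: smult_add_left sum.distrib if_distrib[of "\<lambda>c. smult c _"]
          sum.delta cong: if_cong)
    thus ?case by (intro exI)
  qed
next
  assume "\<exists>\<alpha>. g = (\<Sum>i\<in>I. smult (\<alpha> i) (p i))"
  thus "g \<in> poly_vs.span (p ` I)"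
    by (auto intro!: poly_vs.span_sum intro: poly_vs.span_scale poly_vs.span_base)
qed

section \<open>Polynomials with prescribed exponents and maximal order at 1\<close>

text \<open>
  For \<open>n \<in> S\<close> this is \<open>W'(n)\<close> with \<open>W(x) = \<Prod>m\<in>S. (x - m)\<close>, so
  its reciprocals are the coefficients of the divided difference on the nodes \<open>S\<close>.
\<close>

definition node_weight :: "nat set \<Rightarrow> nat \<Rightarrow> complex" where
  "node_weight S n = (\<Prod>m\<in>S - {n}. of_nat n - of_nat m)"

lemma node_weight_nonzero: "finite S \<Longrightarrow> node_weight S n \<noteq> 0"
  by (auto simp: node_weight_def)

text \<open>
  With \<open>\<nu> + 1\<close> admissible exponents and a zero of order \<open>\<nu>\<close> at \<open>1\<close>,
  all moments of degree below \<open>\<nu>\<close> vanish. Testing with the polynomial that vanishes on all nodes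
  but two leaves a two-term relation between the coefficients at these two nodes. So such a \<open>g\<close> is
  unique up to a factor.
\<close>

lemma coeff_times_node_weight_const:
  assumes S: "finite S" "card S = Suc \<nu>"
    and supp: "\<And>n. n \<notin> S \<Longrightarrow> coeff g n = 0"
    and dvd: "[:-1, 1:] ^ \<nu> dvd g"
    and n: "n \<in> S" "n' \<in> S"
  shows "coeff g n * node_weight S n = coeff g n' * node_weight S n'"
proof (cases "n = n'")
  case False
  define T where "T = S - {n, n'}"
  define q where "q = (\<Prod>m\<in>T. [:- of_nat m, 1:] :: complex poly)"
  have "degree q = card T" unfolding q_def by (subst degree_prod_eq_sum_degree) auto
  hence dq: "degree q < \<nu>" using S n False card_Diff_subset[of "{n,n'}" S] card_mono[of S "{n,n'}"]
    by (simp add: T_def)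
  obtain h where "g = [:-1, 1:] ^ \<nu> * h" using dvd by blast
  hence "moment g q = 0" using moment_multiple[of q \<nu> h] dq by (simp add: coeff_eq_0)
  also have "moment g q = (\<Sum>i\<in>{n, n'}. coeff g i * poly q (of_nat i))"
  proof -
    have fS: "finite T" using S by (simp add: T_def)
    have "moment g q = (\<Sum>i\<le>max (degree g) (max n n'). coeff g i * poly q (of_nat i))"
      by (intro moment_bound) simp
    also have "\<dots> = (\<Sum>i\<in>{n, n'}. coeff g i * poly q (of_nat i))"
    proof (rule sum.mono_neutral_right)
      show "\<forall>i\<in>{..max (degree g) (max n n')} - {n, n'}. coeff g i * poly q (of_nat i) = 0"
        using supp fS by (auto simp: q_def poly_prod T_def)
    qed auto
    finally show ?thesis .
  qed
  finally have eq: "coeff g n * poly q (of_nat n) + coeff g n' * poly q (of_nat n') = 0"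
    using False by simp
  have w: "node_weight S n = (of_nat n - of_nat n') * poly q (of_nat n)"
  proof -
    have "S - {n} = insert n' T" "n' \<notin> T" using n False by (auto simp: T_def)
    moreover have "finite T" using S by (simp add: T_def)
    ultimately show ?thesis by (simp only: node_weight_def q_def prod.insert poly_prod) simp
  qed
  have w': "node_weight S n' = (of_nat n' - of_nat n) * poly q (of_nat n')"
  proof -
    have "S - {n'} = insert n T" "n \<notin> T" using n False by (auto simp: T_def)
    moreover have "finite T" using S by (simp add: T_def)
    ultimately show ?thesis by (simp only: node_weight_def q_def prod.insert poly_prod) simp
  qed
  have "coeff g n * node_weight S n - coeff g n' * node_weight S n'
      = (of_nat n - of_nat n') * (coeff g n * poly q (of_nat n) + coeff g n' * poly q (of_nat n'))"
    unfolding w w' by (simp add: algebra_simps)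
  thus ?thesis using eq by simp
qed simp

section \<open>The two leading coefficients of products of linear factors\<close>

text \<open>
  Monic of degree \<open>N + 1\<close> with second coefficient \<open>s\<close>. The degree is written with a
  successor so that the second coefficient always exists.
\<close>

definition top_coeffs :: "nat \<Rightarrow> complex \<Rightarrow> complex poly \<Rightarrow> bool" where
  "top_coeffs N s p \<longleftrightarrow> degree p \<le> Suc N \<and> coeff p (Suc N) = 1 \<and> coeff p N = s"

lemma top_coeffs_mult_linear:
  assumes "top_coeffs N s p"
  shows "top_coeffs (Suc N) (s - z) ([:-z, 1:] * p)"
proof -
  have "degree ([:-z, 1:] * p) \<le> Suc (Suc N)"
    using assms degree_mult_le[of "[:-z,1:]" p] by (simp add: top_coeffs_def)
  thus ?thesis using assms by (auto simp: top_coeffs_def coeff_eq_0)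
qed

lemma top_coeffs_prod:
  "top_coeffs r (- (\<Sum>i\<le>r. z i)) (\<Prod>i\<le>r. [:- z i, 1:])"
proof (induction r)
  case 0
  show ?case by (simp add: top_coeffs_def)
next
  case (Suc r)
  show ?case using top_coeffs_mult_linear[OF Suc.IH, of "z (Suc r)"]
    by (simp only: prod.atMost_Suc sum.atMost_Suc mult.commute[of "prod _ _"] minus_add_distrib
        diff_conv_add_uminus)
qed

lemma top_coeffs_mult_power:
  assumes "top_coeffs N s p"
  shows "top_coeffs (N + j) (s - of_nat j * z) ([:-z, 1:] ^ j * p)"
proof (induction j)
  case (Suc j)
  have "s - of_nat j * z - z = s - of_nat (Suc j) * z" by (simp add: algebra_simps)
  thus ?case using top_coeffs_mult_linear[OF Suc.IH, of z]
    by (simp only: power_Suc mult.assoc add_Suc_right)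
qed (use assms in simp)

section \<open>Interlacing exponents and the hypergeometric recurrence\<close>

text \<open>
  Interlacing \<open>a\<^sub>0 \<le> d\<^sub>0 < a\<^sub>1 \<le> d\<^sub>1 < \<dots> < a\<^sub>r \<le>
  d\<^sub>r\<close> makes the intervals \<open>[a\<^sub>i, d\<^sub>i]\<close> disjoint. The \<open>a\<^sub>i\<close>
  will be the orders at \<open>0\<close> and the \<open>d\<^sub>i\<close> the degrees.
\<close>

locale interlacing =
  fixes a d :: "nat \<Rightarrow> nat" and r :: nat
  assumes a_le_d: "i \<le> r \<Longrightarrow> a i \<le> d i"
    and d_less_a_Suc: "i < r \<Longrightarrow> d i < a (Suc i)"
begin

lemma d_less_a: "i < j \<Longrightarrow> j \<le> r \<Longrightarrow> d i < a j"
proof (induction j)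
  case (Suc j)
  show ?case
  proof (cases "i = j")
    case False
    hence "d i < a j" using Suc by simp
    also have "a j \<le> d j" using Suc by (intro a_le_d) simp
    also have "d j < a (Suc j)" using Suc by (intro d_less_a_Suc) simp
    finally show ?thesis .
  qed (use Suc d_less_a_Suc in simp)
qed simp

lemma d_less_d: "i < j \<Longrightarrow> j \<le> r \<Longrightarrow> d i < d j"
  using d_less_a[of i j] a_le_d[of j] by simp

lemma d_inj: "i \<le> r \<Longrightarrow> j \<le> r \<Longrightarrow> d i = d j \<longleftrightarrow> i = j"
  using d_less_d[of i j] d_less_d[of j i] by (cases i j rule: linorder_cases) auto

lemma block_unique:
  assumes "i \<le> r" "j \<le> r" "n \<in> {a i..d i}" "n \<in> {a j..d j}"
  shows "i = j"
  using d_less_a[of i j] d_less_a[of j i] assms by (cases i j rule: linorder_cases) auto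

lemma blocks_disjoint: "i \<le> r \<Longrightarrow> j \<le> r \<Longrightarrow> i \<noteq> j \<Longrightarrow> {a i..d i} \<inter> {a j..d j} = {}"
  using block_unique by blast

definition nodes :: "nat set" where
  "nodes = (\<Union>i\<le>r. {a i..d i})"

definition excess :: nat where
  "excess = (\<Sum>i\<le>r. d i - a i)"

text \<open>
  These are the parts, one for each interval, of the polynomial with exponents in \<open>nodes\<close> that vanishes
  to the largest possible order at \<open>1\<close>.
\<close>

definition block_poly :: "nat \<Rightarrow> complex poly" where
  "block_poly i = (\<Sum>n=a i..d i. monom (inverse (node_weight nodes n)) n)"

abbreviation block_space :: "complex poly set" where
  "block_space \<equiv> poly_vs.span (block_poly ` {..r})"

text \<open>
  The elements of the space solve the hypergeometric equation \<open>P(\<theta>) g = x Q(\<theta>) g\<close> with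
  \<open>\<theta> = x d/dx\<close>. Here \<open>P\<close> is \<open>indicial0\<close>, whose roots are the exponents
  at \<open>0\<close>, and \<open>Q\<close> is \<open>indicial_inf\<close>, whose roots are the degrees.
\<close>

definition indicial0 :: "complex poly" where
  "indicial0 = (\<Prod>i\<le>r. [:- of_nat (a i), 1:])"

definition indicial_inf :: "complex poly" where
  "indicial_inf = (\<Prod>i\<le>r. [:- of_nat (d i), 1:])"

lemma finite_nodes [simp]: "finite nodes"
  by (simp add: nodes_def)

lemma card_nodes: "card nodes = Suc (r + excess)"
proof -
  have "card nodes = (\<Sum>i\<le>r. card {a i..d i})"
    unfolding nodes_def by (intro card_UN_disjoint ballI impI blocks_disjoint) auto
  also have "\<dots> = (\<Sum>i\<le>r. (d i - a i) + 1)"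
    by (intro sum.cong) (auto simp: a_le_d Suc_diff_le)
  also have "\<dots> = Suc (r + excess)" by (simp only: sum.distrib) (simp add: excess_def)
  finally show ?thesis .
qed

lemma coeff_combination:
  assumes "\<And>j n. j \<le> r \<Longrightarrow> n \<notin> {a j..d j} \<Longrightarrow> coeff (p j) n = 0"
    and "i \<le> r" "n \<in> {a i..d i}"
  shows "coeff (\<Sum>j\<le>r. smult (\<alpha> j) (p j)) n = \<alpha> i * coeff (p i) n"
proof -
  have "coeff (\<Sum>j\<le>r. smult (\<alpha> j) (p j)) n = (\<Sum>j\<le>r. \<alpha> j * coeff (p j) n)"
    by (simp add: coeff_sum)
  also have "\<dots> = (\<Sum>j\<in>{i}. \<alpha> j * coeff (p j) n)"
  proof (rule sum.mono_neutral_right)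
    show "\<forall>j\<in>{..r} - {i}. \<alpha> j * coeff (p j) n = 0"
    proof
      fix j assume j: "j \<in> {..r} - {i}"
      hence "n \<notin> {a j..d j}" using block_unique[of j i n] assms(2,3) by auto
      thus "\<alpha> j * coeff (p j) n = 0" using assms(1) j by simp
    qed
  qed (use assms in auto)
  finally show ?thesis by simp
qed

lemma coeff_combination_outside:
  assumes "\<And>j n. j \<le> r \<Longrightarrow> n \<notin> {a j..d j} \<Longrightarrow> coeff (p j) n = 0"
    and "n \<notin> nodes"
  shows "coeff (\<Sum>j\<le>r. smult (\<alpha> j) (p j)) n = 0"
proof -
  have "coeff (\<Sum>j\<le>r. smult (\<alpha> j) (p j)) n = (\<Sum>j\<le>r. \<alpha> j * coeff (p j) n)"
    by (simp add: coeff_sum)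
  also have "\<dots> = 0"
    using assms by (intro sum.neutral) (auto simp: nodes_def)
  finally show ?thesis .
qed

lemma coeff_block_poly:
  "coeff (block_poly i) n = (if n \<in> {a i..d i} then inverse (node_weight nodes n) else 0)"
  by (simp add: block_poly_def coeff_sum)

lemma coeff_block_poly_outside: "n \<notin> {a i..d i} \<Longrightarrow> coeff (block_poly i) n = 0"
  by (simp only: coeff_block_poly if_False)

lemma degree_block_poly: "i \<le> r \<Longrightarrow> degree (block_poly i) = d i"
  using a_le_d[of i]
  by (intro antisym degree_le le_degree) (auto simp: coeff_block_poly node_weight_nonzero)

text \<open>
  On an interval, \<open>x \<mapsto> x + 1\<close> changes \<open>\<Prod>m=a..d. (x - m)\<close> only at its two
  ends. Hence \<open>W(x + 1) Q(x) = W(x) P(x + 1)\<close> for \<open>W(x) = \<Prod>m\<in>nodes. (x - m)\<close>.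
  The claim follows after cancelling the zero that \<open>W(x)\<close> and \<open>W(x + 1)\<close> share at \<open>x
  = n\<close>.
\<close>

lemma node_weight_Suc:
  assumes "i \<le> r" "a i \<le> n" "n < d i"
  shows "node_weight nodes (Suc n) * poly indicial_inf (of_nat n)
       = node_weight nodes n * poly indicial0 (of_nat (Suc n))"
proof -
  define W where "W = (\<Prod>m\<in>nodes. [:- of_nat m, 1:] :: complex poly)"
  define R where "R n = (\<Prod>m\<in>nodes - {n}. [:- of_nat m, 1:] :: complex poly)" for n
  have block: "(\<Prod>m=x..y. [:- of_nat m, 1:]) \<circ>\<^sub>p [:1, 1:] * [:- of_nat y, 1:]
      = (\<Prod>m=x..y. [:- of_nat m, 1:]) * [:1 - of_nat x, 1 :: complex:]" if "x \<le> y" for x y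
    using that
  proof (induction y rule: dec_induct)
    case base
    show ?case by (simp add: pcompose_pCons)
  next
    case (step y)
    let ?B = "(\<Prod>m=x..y. [:- of_nat m, 1:]) :: complex poly"
    have "(\<Prod>m=x..Suc y. [:- of_nat m, 1:]) = ?B * [:- of_nat (Suc y), 1:]"
      using step by (simp add: prod.nat_ivl_Suc')
    moreover have "[:- of_nat (Suc y), 1:] \<circ>\<^sub>p [:1, 1:] = [:- of_nat y, 1 :: complex:]"
      by (simp add: pcompose_pCons)
    ultimately show ?case using step.IH by (simp only: pcompose_mult) (simp only: mult_ac)
  qed
  have W: "W = (\<Prod>i\<le>r. \<Prod>m=a i..d i. [:- of_nat m, 1:])"
    unfolding W_def nodes_def by (intro prod.UNION_disjoint ballI impI blocks_disjoint) auto
  have P: "indicial0 \<circ>\<^sub>p [:1, 1:] = (\<Prod>i\<le>r. [:1 - of_nat (a i), 1:])"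
    by (simp add: indicial0_def pcompose_prod pcompose_pCons)
  have "W \<circ>\<^sub>p [:1, 1:] * indicial_inf
      = (\<Prod>i\<le>r. (\<Prod>m=a i..d i. [:- of_nat m, 1:]) \<circ>\<^sub>p [:1, 1:] * [:- of_nat (d i), 1:])"
    by (simp only: W indicial_inf_def pcompose_prod prod.distrib)
  also have "\<dots> = (\<Prod>i\<le>r. (\<Prod>m=a i..d i. [:- of_nat m, 1:]) * [:1 - of_nat (a i), 1:])"
    by (intro prod.cong refl block a_le_d) simp
  also have "\<dots> = W * indicial0 \<circ>\<^sub>p [:1, 1:]"
    by (simp only: W P prod.distrib)
  finally have shift: "W \<circ>\<^sub>p [:1, 1:] * indicial_inf = W * indicial0 \<circ>\<^sub>p [:1, 1:]" .
  have fac: "W = [:- of_nat n, 1:] * R n" if "n \<in> nodes" for n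
    unfolding W_def R_def using that by (intro prod.remove) auto
  have n: "n \<in> nodes" "Suc n \<in> nodes" using assms unfolding nodes_def by force+
  have "[:- of_nat (Suc n), 1:] \<circ>\<^sub>p [:1, 1:] = [:- of_nat n, 1 :: complex:]"
    by (simp add: pcompose_pCons)
  hence "W \<circ>\<^sub>p [:1, 1:] = [:- of_nat n, 1:] * R (Suc n) \<circ>\<^sub>p [:1, 1:]"
    by (simp only: fac[OF n(2)] pcompose_mult)
  hence "[:- of_nat n, 1:] * (R (Suc n) \<circ>\<^sub>p [:1, 1:] * indicial_inf)
      = [:- of_nat n, 1:] * (R n * indicial0 \<circ>\<^sub>p [:1, 1:])"
    using shift fac[OF n(1)] by (simp only: mult.assoc)
  hence "R (Suc n) \<circ>\<^sub>p [:1, 1:] * indicial_inf = R n * indicial0 \<circ>\<^sub>p [:1, 1:]"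
    by (subst (asm) mult_left_cancel) simp_all
  hence "poly (R (Suc n) \<circ>\<^sub>p [:1, 1:] * indicial_inf) (of_nat n)
      = poly (R n * indicial0 \<circ>\<^sub>p [:1, 1:]) (of_nat n)" by (rule arg_cong)
  moreover have R: "poly (R n) (of_nat n) = node_weight nodes n" for n
    by (simp add: R_def node_weight_def poly_prod)
  ultimately show ?thesis using R[of n] R[of "Suc n"] by (simp add: poly_pcompose)
qed

lemma poly_indicial0_a: "i \<le> r \<Longrightarrow> poly indicial0 (of_nat (a i)) = 0"
  by (auto simp: indicial0_def poly_prod)

lemma poly_indicial_inf_d: "i \<le> r \<Longrightarrow> poly indicial_inf (of_nat (d i)) = 0"
  by (auto simp: indicial_inf_def poly_prod)

text \<open>
  At the two ends of the interval the recurrence holds because \<open>P\<close> vanishes at \<open>a\<^sub>i\<close>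
  and \<open>Q\<close> at \<open>d\<^sub>i\<close>. This is what allows the parts to be scaled independently of each
  other.
\<close>

lemma block_poly_recurrence:
  assumes "i \<le> r"
  shows "coeff (block_poly i) (Suc n) * poly indicial0 (of_nat (Suc n))
       = coeff (block_poly i) n * poly indicial_inf (of_nat n)"
proof -
  consider "a i \<le> n" "n < d i" | "Suc n = a i" | "n = d i" | "n \<notin> {a i..d i}" "Suc n \<notin> {a i..d i}"
    by force
  thus ?thesis
  proof cases
    case 1
    thus ?thesis using node_weight_Suc[OF assms 1]
      by (simp add: coeff_block_poly node_weight_nonzero field_simps del: of_nat_Suc)
  next
    case 2
    thus ?thesis using poly_indicial0_a[OF assms]
      by (simp add: coeff_block_poly del: of_nat_Suc)
  next
    case 3
    thus ?thesis using poly_indicial_inf_d[OF assms]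
      by (simp add: coeff_block_poly del: of_nat_Suc)
  next
    case 4
    thus ?thesis by (simp only: coeff_block_poly if_False mult_zero_left)
  qed
qed

lemma block_poly_recurrence_0:
  assumes "i \<le> r"
  shows "coeff (block_poly i) 0 * poly indicial0 0 = 0"
  using poly_indicial0_a[OF assms] by (auto simp: coeff_block_poly)

lemma block_space_recurrence:
  assumes "g \<in> block_space"
  shows "coeff g (Suc n) * poly indicial0 (of_nat (Suc n)) = coeff g n * poly indicial_inf (of_nat n)"
    and "coeff g 0 * poly indicial0 0 = 0"
proof -
  obtain \<alpha> where g: "g = (\<Sum>i\<le>r. smult (\<alpha> i) (block_poly i))"
    using assms by (auto simp: span_image_sum)
  have "coeff g (Suc n) * poly indicial0 (of_nat (Suc n))
      = (\<Sum>i\<le>r. \<alpha> i * (coeff (block_poly i) (Suc n) * poly indicial0 (of_nat (Suc n))))"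
    by (simp add: g coeff_sum sum_distrib_right mult.assoc del: of_nat_Suc)
  also have "\<dots> = (\<Sum>i\<le>r. \<alpha> i * (coeff (block_poly i) n * poly indicial_inf (of_nat n)))"
    by (intro sum.cong refl) (simp only: block_poly_recurrence atMost_iff)
  also have "\<dots> = coeff g n * poly indicial_inf (of_nat n)"
    by (simp add: g coeff_sum sum_distrib_right mult.assoc)
  finally show "coeff g (Suc n) * poly indicial0 (of_nat (Suc n))
      = coeff g n * poly indicial_inf (of_nat n)" .
  have "coeff g 0 * poly indicial0 0 = (\<Sum>i\<le>r. \<alpha> i * (coeff (block_poly i) 0 * poly indicial0 0))"
    by (simp add: g coeff_sum sum_distrib_right mult.assoc)
  also have "\<dots> = 0" using block_poly_recurrence_0 by (intro sum.neutral) auto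
  finally show "coeff g 0 * poly indicial0 0 = 0" .
qed

text \<open>
  The differential equation paired with \<open>\<beta>(\<theta>)\<close> at \<open>x = 1\<close>: summation by parts
  turns the coefficient recurrence into a relation between moments.
\<close>

lemma moment_block_space:
  assumes "g \<in> block_space"
  shows "moment g (indicial0 * \<beta> - indicial_inf * (\<beta> \<circ>\<^sub>p [:1, 1:])) = 0"
proof -
  define D where "D = degree g"
  define F where "F n = coeff g n * poly indicial0 (of_nat n) * poly \<beta> (of_nat n)" for n
  have "(\<Sum>n\<le>D. F n) = (\<Sum>n\<le>Suc D. F n)"
    by (simp add: F_def D_def coeff_eq_0)
  also have "\<dots> = F 0 + (\<Sum>n\<le>D. F (Suc n))" by (rule sum.atMost_Suc_shift)
  also have "F 0 = 0" using block_space_recurrence(2)[OF assms] by (simp add: F_def)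
  also have "(\<Sum>n\<le>D. F (Suc n))
      = (\<Sum>n\<le>D. coeff g n * poly indicial_inf (of_nat n) * poly \<beta> (of_nat (Suc n)))"
    unfolding F_def block_space_recurrence(1)[OF assms] ..
  finally have "(\<Sum>n\<le>D. F n - coeff g n * poly indicial_inf (of_nat n) * poly \<beta> (of_nat (Suc n))) = 0"
    by (simp add: sum_subtractf)
  thus ?thesis
    by (simp add: moment_def D_def F_def poly_pcompose algebra_simps)
qed

text \<open>
  The indicial equation at \<open>1\<close>. Let \<open>g\<close> vanish to order exactly \<open>r + j\<close> and
  take \<open>\<beta> = x\<^sup>j\<close>. The terms of degree \<open>r + 1 + j\<close> of \<open>P \<beta> - Q
  \<beta>(x + 1)\<close> cancel, and the coefficient of degree \<open>r + j\<close> is \<open>(\<Sum>i\<le>r.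
  d\<^sub>i - a\<^sub>i) - j\<close>. The moment of \<open>g\<close> against this polynomial is zero, and it is also
  a non-zero multiple of that coefficient.
\<close>

lemma order_1_block_space:
  assumes "g \<in> block_space" "g \<noteq> 0" "r \<le> order 1 g"
  shows "order 1 g = r + excess"
proof -
  define j where "j = order 1 g - r"
  have j: "order 1 g = r + j" using assms(3) by (simp add: j_def)
  \<comment> \<open>The difference \<open>P \<beta> - Q \<beta>(x + 1)\<close> for \<open>\<beta> = x\<^sup>j\<close>.\<close>
  define q where "q = indicial0 * [:0, 1:] ^ j - indicial_inf * [:1, 1:] ^ j"
  have shift: "([:0, 1:] ^ j) \<circ>\<^sub>p [:1, 1:] = ([:1, 1:] ^ j :: complex poly)"
    by (induction j) (simp_all add: pcompose_mult pcompose_pCons pcompose_1 del: mult_pCons_left)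
  have "top_coeffs (r + j) (- (\<Sum>i\<le>r. of_nat (a i)) - of_nat j * 0) ([:- 0, 1:] ^ j * indicial0)"
    unfolding indicial0_def by (intro top_coeffs_mult_power top_coeffs_prod)
  moreover have "top_coeffs (r + j) (- (\<Sum>i\<le>r. of_nat (d i)) - of_nat j * (-1)) ([:- (-1), 1:] ^ j * indicial_inf)"
    unfolding indicial_inf_def by (intro top_coeffs_mult_power top_coeffs_prod)
  ultimately have *: "degree q \<le> Suc (r + j)" "coeff q (Suc (r + j)) = 0"
    "coeff q (r + j) = (\<Sum>i\<le>r. of_nat (d i)) - (\<Sum>i\<le>r. of_nat (a i)) - of_nat j"
    by (auto simp: q_def top_coeffs_def mult.commute[of _ indicial0] mult.commute[of _ indicial_inf]
        intro!: degree_diff_le)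
  have deg: "degree q \<le> r + j"
    using *(1,2) by (metis degree_0 le_SucE le_zero_eq leading_coeff_0_iff nat_le_linear)
  have "(of_nat excess :: complex) = (\<Sum>i\<le>r. of_nat (d i) - of_nat (a i))"
    unfolding excess_def of_nat_sum by (intro sum.cong refl) (simp add: of_nat_diff a_le_d)
  hence co: "coeff q (r + j) = of_nat excess - of_nat j" using *(3) by (simp add: sum_subtractf)
  obtain h where h: "g = [:-1, 1:] ^ (r + j) * h" "poly h 1 \<noteq> 0"
    using order_1_factor[OF assms(2)] j by metis
  have "0 = moment g q"
    using moment_block_space[OF assms(1), of "[:0,1:] ^ j"] by (simp add: q_def shift)
  also have "\<dots> = fact (r + j) * coeff q (r + j) * poly h 1"
    unfolding h(1) using deg by (rule moment_multiple)
  finally have "(of_nat excess :: complex) = of_nat j" using h(2) co by simp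
  thus ?thesis using j by simp
qed

section \<open>Dimension, degrees and orders of the block space\<close>

lemma dim_block_space: "poly_vs.dim block_space = r + 1"
proof -
  have inj: "inj_on block_poly {..r}"
    by (rule inj_onI) (metis atMost_iff d_inj degree_block_poly)
  have "poly_vs.independent (block_poly ` {..r})"
  proof (rule poly_vs.independent_if_scalars_zero)
    fix f x assume sum0: "(\<Sum>x\<in>block_poly ` {..r}. smult (f x) x) = 0" and x: "x \<in> block_poly ` {..r}"
    then obtain i where i: "i \<le> r" "x = block_poly i" by auto
    have "0 = coeff (\<Sum>j\<le>r. smult (f (block_poly j)) (block_poly j)) (d i)"
      using sum0 by (simp add: sum.reindex[OF inj])
    also have "\<dots> = f x * coeff (block_poly i) (d i)"
      unfolding i(2) using i a_le_d by (intro coeff_combination) (auto simp: coeff_block_poly)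
    finally show "f x = 0" using i a_le_d by (simp add: coeff_block_poly node_weight_nonzero)
  qed simp
  thus ?thesis using inj by (simp add: poly_vs.dim_eq_card_independent card_image)
qed

text \<open>
  The coefficients of an element are, on each interval, a common factor times those of the block polynomial, which
  are all non-zero. So they vanish on the whole interval or nowhere on it.
\<close>

lemma coeff_block_space_nonzero:
  assumes "g \<in> block_space" "coeff g n \<noteq> 0"
  obtains i where "i \<le> r" "n \<in> {a i..d i}" "\<And>n'. n' \<in> {a i..d i} \<Longrightarrow> coeff g n' \<noteq> 0"
proof -
  obtain \<alpha> where g: "g = (\<Sum>i\<le>r. smult (\<alpha> i) (block_poly i))"
    using assms by (auto simp: span_image_sum)
  have "n \<in> nodes"
    using coeff_combination_outside[of block_poly, OF coeff_block_poly_outside] assms(2) g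
    by blast
  then obtain i where i: "i \<le> r" "n \<in> {a i..d i}" by (auto simp: nodes_def)
  have co: "coeff g n' = \<alpha> i * inverse (node_weight nodes n')" if "n' \<in> {a i..d i}" for n'
    unfolding g using that
    by (subst coeff_combination[OF coeff_block_poly_outside i(1)]) (simp_all add: coeff_block_poly)
  hence "\<alpha> i \<noteq> 0" using i assms(2) by auto
  thus ?thesis using that[OF i] co by (simp add: node_weight_nonzero)
qed

lemma block_poly_in_space: "i \<le> r \<Longrightarrow> block_poly i \<in> block_space"
  by (intro poly_vs.span_base) simp

lemma block_poly_nonzero: "i \<le> r \<Longrightarrow> block_poly i \<noteq> 0"
  using coeff_block_poly[of i "d i"] a_le_d[of i] by (auto simp: node_weight_nonzero)

lemma degrees_block_space: "{degree p | p. p \<in> block_space \<and> p \<noteq> 0} = d ` {..r}"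
proof safe
  fix p assume p: "p \<in> block_space" "p \<noteq> 0"
  then obtain i where i: "i \<le> r" "degree p \<in> {a i..d i}"
      "\<And>n'. n' \<in> {a i..d i} \<Longrightarrow> coeff p n' \<noteq> 0"
    using coeff_block_space_nonzero[of p "degree p"] by auto
  hence "d i \<le> degree p" using a_le_d by (intro le_degree) auto
  thus "degree p \<in> d ` {..r}" using i by auto
next
  fix i assume "i \<le> r"
  thus "\<exists>p. d i = degree p \<and> p \<in> block_space \<and> p \<noteq> 0"
    using degree_block_poly block_poly_in_space block_poly_nonzero by metis
qed

lemma orders_0_block_space: "{order 0 p | p. p \<in> block_space \<and> p \<noteq> 0} = a ` {..r}"
proof safe
  fix p assume p: "p \<in> block_space" "p \<noteq> 0"
  obtain i where i: "i \<le> r" "order 0 p \<in> {a i..d i}"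
    "\<And>n'. n' \<in> {a i..d i} \<Longrightarrow> coeff p n' \<noteq> 0"
    using coeff_block_space_nonzero[OF p(1) order_0_coeff(1)[OF p(2)]] by blast
  hence "\<not> a i < order 0 p" using order_0_coeff(2)[OF p(2), of "a i"] a_le_d by force
  hence "order 0 p = a i" using i(2) by simp
  thus "order 0 p \<in> a ` {..r}" using i(1) by blast
next
  fix i assume i: "i \<le> r"
  note nz = block_poly_nonzero[OF i]
  have "order 0 (block_poly i) = a i"
  proof (rule antisym)
    show "order 0 (block_poly i) \<le> a i"
      using order_0_coeff(2)[OF nz, of "a i"] a_le_d[OF i]
      by (force simp: coeff_block_poly node_weight_nonzero)
    show "a i \<le> order 0 (block_poly i)"
      using order_0_coeff(1)[OF nz] by (auto simp: coeff_block_poly split: if_splits)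
  qed
  thus "\<exists>p. a i = order 0 p \<and> p \<in> block_space \<and> p \<noteq> 0"
    using block_poly_in_space i nz by metis
qed

text \<open>
  The indicial equation leaves \<open>r + 1\<close> possible orders, and a space of dimension \<open>r + 1\<close>
  needs that many.
\<close>

lemma orders_1_block_space:
  "{order 1 p | p. p \<in> block_space \<and> p \<noteq> 0} = {..<r} \<union> {r + excess}" (is "?O = ?T")
proof (rule card_subset_eq)
  show fin: "finite ?T" by simp
  show sub: "?O \<subseteq> ?T"
    using order_1_block_space by (auto simp: not_le[symmetric])
  have "card ?T = r + 1" by simp
  moreover have "r + 1 \<le> card ?O"
    using dim_le_card_orders[of block_space 1] finite_subset[OF sub fin] dim_block_space by auto
  ultimately show "card ?O = card ?T" using card_mono[OF fin sub] by linarith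
qed


section \<open>Uniqueness of the space\<close>

text \<open>
  Among the elements of degree \<open>d\<^sub>i\<close>, one of maximal order at \<open>0\<close> must have order
  \<open>a\<^sub>i\<close>. Orders above \<open>a\<^sub>i\<close> exceed \<open>d\<^sub>i\<close>, and an order
  \<open>a\<^sub>j\<close> with \<open>j < i\<close> could be raised by the element already found for
  \<open>j\<close>, whose degree is too small to matter.
\<close>

lemma adapted_element:
  assumes V: "poly_vs.subspace V"
    and degs: "{degree p | p. p \<in> V \<and> p \<noteq> 0} = d ` {..r}"
    and ords: "{order 0 p | p. p \<in> V \<and> p \<noteq> 0} = a ` {..r}"
    and "i \<le> r"
  shows "\<exists>p\<in>V. p \<noteq> 0 \<and> degree p = d i \<and> order 0 p = a i"
  using \<open>i \<le> r\<close>
proof (induction i rule: less_induct)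
  case (less i)
  define A where "A = {p \<in> V. p \<noteq> 0 \<and> degree p = d i}"
  have "d i \<in> {degree p | p. p \<in> V \<and> p \<noteq> 0}" using degs less.prems by auto
  hence "A \<noteq> {}" by (auto simp: A_def)
  have "order 0 ` A \<subseteq> {..d i}" by (auto simp: A_def dest: order_degree)
  hence fin: "finite (order 0 ` A)" by (rule finite_subset) simp
  hence "Max (order 0 ` A) \<in> order 0 ` A" using \<open>A \<noteq> {}\<close> by (intro Max_in) auto
  then obtain q where q: "q \<in> A" "order 0 q = Max (order 0 ` A)" by force
  have "order 0 q \<in> a ` {..r}" using q(1) ords by (auto simp: A_def)
  then obtain j where j: "j \<le> r" "order 0 q = a j" by auto
  have "a j \<le> d i" using q(1) j(2) order_degree[of q 0] by (auto simp: A_def)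
  hence "j \<le> i" using d_less_a[of i j] j(1) by (meson leD leI)
  moreover have "\<not> j < i"
  proof
    assume "j < i"
    then obtain p where p: "p \<in> V" "p \<noteq> 0" "degree p = d j" "order 0 p = a j"
      using less.IH[of j] j(1) by blast
    obtain c where c: "q - smult c p = 0 \<or> order 0 q < order 0 (q - smult c p)"
      using order_cancel[of q p 0] q(1) p j(2) by (auto simp: A_def)
    have "degree p < d i" using p(3) d_less_d[OF \<open>j < i\<close> less.prems] by simp
    hence "coeff (q - smult c p) (d i) = coeff q (d i)" by (simp add: coeff_eq_0)
    moreover have "degree q = d i" "q \<noteq> 0" using q(1) by (auto simp: A_def)
    ultimately have co: "coeff (q - smult c p) (d i) \<noteq> 0" by (metis leading_coeff_0_iff)
    have "degree (q - smult c p) \<le> d i"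
      using \<open>degree p < d i\<close> \<open>degree q = d i\<close> degree_smult_le[of c p]
      by (intro degree_diff_le) auto
    hence "degree (q - smult c p) = d i" using le_degree[OF co] by simp
    moreover have "q - smult c p \<noteq> 0" using co by auto
    moreover have "q - smult c p \<in> V"
      using q(1) p(1) V by (auto simp: A_def intro: poly_vs.subspace_diff poly_vs.subspace_scale)
    ultimately have "q - smult c p \<in> A" "order 0 q < order 0 (q - smult c p)"
      using c by (auto simp: A_def)
    thus False using q(2) fin by (metis Max_ge imageI leD)
  qed
  ultimately show ?case using q(1) j by (auto simp: A_def)
qed

text \<open>
  Elements of \<open>V\<close> reduce to zero by repeatedly cancelling the leading term.
\<close>

lemma subset_span_adapted:
  assumes V: "poly_vs.subspace V"
    and degs: "{degree p | p. p \<in> V \<and> p \<noteq> 0} = d ` {..r}"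
    and p: "\<And>i. i \<le> r \<Longrightarrow> p i \<in> V \<and> p i \<noteq> 0 \<and> degree (p i) = d i"
  shows "V \<subseteq> poly_vs.span (p ` {..r})"
proof
  fix x assume "x \<in> V"
  thus "x \<in> poly_vs.span (p ` {..r})"
  proof (induction "degree x" arbitrary: x rule: less_induct)
    case less
    show ?case
    proof (cases "x = 0")
      case False
      hence "degree x \<in> d ` {..r}" using degs less.prems by auto
      then obtain i where i: "i \<le> r" "degree x = d i" by auto
      define c where "c = lead_coeff x / lead_coeff (p i)"
      define y where "y = x - smult c (p i)"
      have "y \<in> V" unfolding y_def
        using less.prems V p[OF i(1)] by (auto intro: poly_vs.subspace_diff poly_vs.subspace_scale)
      have "degree y \<le> degree x" unfolding y_def
        using p[OF i(1)] i(2) degree_smult_le[of c "p i"] by (intro degree_diff_le) auto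
      moreover have "coeff y (degree x) = 0"
        using p[OF i(1)] i(2) leading_coeff_0_iff[of "p i"] by (simp add: y_def c_def)
      ultimately have "y = 0 \<or> degree y < degree x"
        by (metis le_neq_implies_less leading_coeff_0_iff)
      hence "y \<in> poly_vs.span (p ` {..r})"
        using less.hyps[OF _ \<open>y \<in> V\<close>] by (auto intro: poly_vs.span_zero)
      moreover have "x = y + smult c (p i)" by (simp add: y_def)
      ultimately show ?thesis using i(1)
        by (metis atMost_iff imageI poly_vs.span_add poly_vs.span_base poly_vs.span_scale)
    qed (simp add: poly_vs.span_zero)
  qed
qed

text \<open>
  Degrees and orders at \<open>0\<close> give a basis \<open>p\<^sub>i\<close> of \<open>V\<close> with
  \<open>p\<^sub>i\<close> supported on \<open>[a\<^sub>i, d\<^sub>i]\<close>. The element of order \<open>r +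
  excess\<close> at \<open>1\<close> is a combination of the \<open>p\<^sub>i\<close>, and its coefficients are
  known up to one common factor. Reading it interval by interval gives every \<open>p\<^sub>i\<close> up to a
  factor.
\<close>

lemma block_space_unique:
  assumes V: "poly_vs.subspace V"
    and degs: "{degree p | p. p \<in> V \<and> p \<noteq> 0} = d ` {..r}"
    and ords: "{order 0 p | p. p \<in> V \<and> p \<noteq> 0} = a ` {..r}"
    and ord1: "r + excess \<in> {order 1 p | p. p \<in> V \<and> p \<noteq> 0}"
  shows "V = block_space"
proof -
  obtain p where p: "\<And>i. i \<le> r \<Longrightarrow> p i \<in> V \<and> p i \<noteq> 0 \<and> degree (p i) = d i \<and> order 0 (p i) = a i"
    using adapted_element[OF V degs ords] by metis
  have V_sub: "V \<subseteq> poly_vs.span (p ` {..r})"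
    using p by (intro subset_span_adapted V degs) auto
  have supp: "coeff (p i) n = 0" if "i \<le> r" "n \<notin> {a i..d i}" for i n
    using p[OF that(1)] that(2) order_0_coeff(2)[of "p i" n] by (auto simp: not_le coeff_eq_0)
  obtain g where g: "g \<in> V" "g \<noteq> 0" "order 1 g = r + excess" using ord1 by auto
  obtain \<alpha> where \<alpha>: "g = (\<Sum>i\<le>r. smult (\<alpha> i) (p i))"
    using span_image_sum[of "{..r}" g p] V_sub g(1) by blast
  have supp_g: "coeff g n = 0" if "n \<notin> nodes" for n
    unfolding \<alpha> using supp that by (rule coeff_combination_outside)
  define n\<^sub>0 where "n\<^sub>0 = degree g"
  define \<kappa> where "\<kappa> = coeff g n\<^sub>0 * node_weight nodes n\<^sub>0"
  have "coeff g n\<^sub>0 \<noteq> 0" using g(2) by (simp add: n\<^sub>0_def)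
  hence n\<^sub>0: "n\<^sub>0 \<in> nodes" and "\<kappa> \<noteq> 0" using supp_g by (auto simp: \<kappa>_def node_weight_nonzero)
  have dvd: "[:-1, 1:] ^ (r + excess) dvd g" using order_1[of 1 g] g(3) by simp
  have co: "coeff g n * node_weight nodes n = \<kappa>" if "n \<in> nodes" for n
    unfolding \<kappa>_def
    using finite_nodes card_nodes supp_g dvd that n\<^sub>0 by (rule coeff_times_node_weight_const)
  have eq: "smult (\<alpha> i) (p i) = smult \<kappa> (block_poly i)" if i: "i \<le> r" for i
  proof (rule poly_eqI)
    fix n
    show "coeff (smult (\<alpha> i) (p i)) n = coeff (smult \<kappa> (block_poly i)) n"
    proof (cases "n \<in> {a i..d i}")
      case True
      hence "\<alpha> i * coeff (p i) n = coeff g n"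
        unfolding \<alpha> using coeff_combination[of p i n \<alpha>] supp i by metis
      moreover have "coeff g n = \<kappa> * inverse (node_weight nodes n)"
        using co[of n] True i by (auto simp: nodes_def node_weight_nonzero field_simps)
      ultimately show ?thesis using True by (simp add: coeff_block_poly)
    next
      case False
      thus ?thesis using supp[OF i False] coeff_block_poly_outside[OF False]
        by (simp only: coeff_smult mult_zero_right)
    qed
  qed
  have "block_poly i \<in> V" if "i \<le> r" for i
  proof -
    have "block_poly i = smult (inverse \<kappa>) (smult (\<alpha> i) (p i))"
      using \<open>\<kappa> \<noteq> 0\<close> by (simp only: eq[OF that]) simp
    thus ?thesis using p[OF that] V by (metis poly_vs.subspace_scale)
  qed
  hence "block_space \<subseteq> V" using V by (intro poly_vs.span_minimal) auto
  moreover have "p i \<in> block_space" if "i \<le> r" for i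
  proof -
    have "\<alpha> i \<noteq> 0" using eq[OF that] block_poly_nonzero[OF that] \<open>\<kappa> \<noteq> 0\<close> by auto
    hence "p i = smult (inverse (\<alpha> i)) (smult \<kappa> (block_poly i))"
      by (simp only: eq[OF that, symmetric]) simp
    thus ?thesis using block_poly_in_space[OF that] by (metis poly_vs.span_scale)
  qed
  hence "poly_vs.span (p ` {..r}) \<subseteq> block_space" by (intro poly_vs.span_minimal) auto
  ultimately show ?thesis using V_sub by blast
qed

section \<open>The monic polynomial of lowest degree\<close>

lemma monic_lowest_degree:
  "u \<in> block_space \<and> degree u = d 0 \<and> lead_coeff u = 1
    \<longleftrightarrow> u = smult (node_weight nodes (d 0)) (block_poly 0)"
proof safe
  assume u: "u \<in> block_space" "degree u = d 0" "lead_coeff u = 1"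
  obtain \<alpha> where \<alpha>: "u = (\<Sum>i\<le>r. smult (\<alpha> i) (block_poly i))"
    using u(1) by (auto simp: span_image_sum)
  have co: "coeff u (d i) = \<alpha> i * inverse (node_weight nodes (d i))" if "i \<le> r" for i
    unfolding \<alpha> using a_le_d[OF that]
    by (subst coeff_combination[OF coeff_block_poly_outside that]) (auto simp: coeff_block_poly)
  have "\<alpha> i = 0" if "i \<le> r" "i \<noteq> 0" for i
    using co[OF that(1)] d_less_d[of 0 i] that u(2) by (simp add: coeff_eq_0 node_weight_nonzero)
  hence "(\<Sum>i\<le>r. smult (\<alpha> i) (block_poly i)) = (\<Sum>i\<in>{0}. smult (\<alpha> i) (block_poly i))"
    by (intro sum.mono_neutral_right) auto
  hence "u = smult (\<alpha> 0) (block_poly 0)" by (simp add: \<alpha>)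
  moreover have "\<alpha> 0 = node_weight nodes (d 0)"
    using co[of 0] u by (simp add: field_simps node_weight_nonzero split: if_splits)
  ultimately show "u = smult (node_weight nodes (d 0)) (block_poly 0)" by simp
next
  show "smult (node_weight nodes (d 0)) (block_poly 0) \<in> block_space"
    by (intro poly_vs.span_scale block_poly_in_space) simp
  show "degree (smult (node_weight nodes (d 0)) (block_poly 0)) = d 0"
    by (simp add: degree_block_poly node_weight_nonzero)
  show "lead_coeff (smult (node_weight nodes (d 0)) (block_poly 0)) = 1"
    using a_le_d[of 0] by (simp add: degree_block_poly node_weight_nonzero coeff_block_poly)
qed

text \<open>
  Each step is one use of the recurrence between the exponents \<open>d\<^sub>0 - i - 1\<close> and \<open>d\<^sub>0
  - i\<close>. The factors of \<open>P\<close> and \<open>Q\<close> with index \<open>0\<close> produce the binomial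
  coefficient, and the others the product over \<open>s\<close>.
\<close>

lemma lowest_coeff_formula:
  assumes a0: "a 0 = 0" and "i \<le> d 0"
  shows "(-1) ^ i * coeff (smult (node_weight nodes (d 0)) (block_poly 0)) (d 0 - i) =
    of_nat (d 0 choose i) * (\<Prod>j<i. \<Prod>s=1..r.
      (of_nat (a s) - of_nat (d 0) + of_nat j) / (of_nat (d s) - of_nat (d 0) + of_nat j + 1))"
  using assms(2)
proof (induction i)
  case 0
  show ?case using a_le_d[of 0] by (simp add: coeff_block_poly node_weight_nonzero)
next
  case (Suc i)
  define L where "L = d 0"
  define n where "n = L - Suc i"
  define c where "c = coeff (smult (node_weight nodes (d 0)) (block_poly 0))"
  define X :: complex where "X = (\<Prod>j<i. \<Prod>s=1..r.
      (of_nat (a s) - of_nat (d 0) + of_nat j) / (of_nat (d s) - of_nat (d 0) + of_nat j + 1))"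
  define A :: complex where "A = (\<Prod>s=1..r. of_nat (a s) - of_nat L + of_nat i)"
  define B :: complex where "B = (\<Prod>s=1..r. of_nat (d s) - of_nat L + of_nat i + 1)"
  have n: "L = n + Suc i" "L - i = Suc n" using Suc.prems by (auto simp: n_def L_def)
  \<comment> \<open>No factor vanishes, because \<open>d\<^sub>s > d\<^sub>0\<close> for \<open>s \<ge> 1\<close>.\<close>
  have Bnz: "B \<noteq> 0"
  proof -
    have "of_nat (d s) - of_nat L + of_nat i + 1 \<noteq> (0 :: complex)" if "s \<in> {1..r}" for s
    proof -
      have "L < d s" using d_less_d[of 0 s] that by (simp add: L_def)
      hence "of_nat (d s) - of_nat L + of_nat i + (1 :: complex) = (of_nat (d s - L + i + 1) :: complex)"
        by (simp add: of_nat_diff)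
      also have "\<dots> \<noteq> 0" by (subst of_nat_eq_0_iff) simp
      finally show ?thesis .
    qed
    thus ?thesis by (auto simp: B_def)
  qed
  have indices: "{..r} = insert 0 {1..r}" by auto
  \<comment> \<open>The signs \<open>(-1)\<^sup>r\<close> of \<open>P\<close> and \<open>Q\<close> cancel in the quotient; the factor of \<open>Q\<close> at index \<open>0\<close>
    leaves one more sign, which the \<open>(-1)\<^sup>i\<close> of the normalisation absorbs.\<close>
  have P: "poly indicial0 (of_nat (Suc n)) = of_nat (Suc n) * ((-1) ^ r * A)"
  proof -
    have "A = (\<Prod>s=1..r. (-1) * (of_nat (Suc n) - of_nat (a s)))"
      unfolding A_def by (intro prod.cong) (auto simp: n(1))
    hence "A = (-1) ^ r * (\<Prod>s=1..r. of_nat (Suc n) - of_nat (a s))"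
      by (simp only: prod.distrib prod_constant card_atLeastAtMost) simp
    hence "(-1) ^ r * A = (\<Prod>s=1..r. of_nat (Suc n) - of_nat (a s))"
      by (simp del: of_nat_Suc)
    thus ?thesis by (simp add: indicial0_def poly_prod indices a0)
  qed
  have Q: "poly indicial_inf (of_nat n) = - of_nat (Suc i) * ((-1) ^ r * B)"
  proof -
    have "B = (\<Prod>s=1..r. (-1) * (of_nat n - of_nat (d s)))"
      unfolding B_def by (intro prod.cong) (auto simp: n(1))
    hence "B = (-1) ^ r * (\<Prod>s=1..r. of_nat n - of_nat (d s))"
      by (simp only: prod.distrib prod_constant card_atLeastAtMost) simp
    hence "(-1) ^ r * B = (\<Prod>s=1..r. of_nat n - of_nat (d s))"
      by simp
    moreover have "of_nat n - of_nat (d 0) = (- of_nat (Suc i) :: complex)"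
      using n(1) by (simp add: L_def)
    moreover have "poly indicial_inf (of_nat n)
        = (of_nat n - of_nat (d 0)) * (\<Prod>s=1..r. of_nat n - of_nat (d s))"
      by (simp add: indicial_inf_def poly_prod indices algebra_simps)
    ultimately show ?thesis by (simp only:)
  qed
  have "c (Suc n) * (of_nat (Suc n) * ((-1) ^ r * A)) = c n * (- of_nat (Suc i) * ((-1) ^ r * B))"
  proof -
    have "coeff (block_poly 0) (Suc n) * (of_nat (Suc n) * ((-1) ^ r * A))
        = coeff (block_poly 0) n * (- of_nat (Suc i) * ((-1) ^ r * B))"
      using block_poly_recurrence[of 0 n] by (simp only: P Q le0)
    thus ?thesis unfolding c_def coeff_smult mult.assoc by (rule arg_cong)
  qed
  hence "(-1) ^ r * (c (Suc n) * (of_nat (Suc n) * A)) = (-1) ^ r * (- (c n * (of_nat (Suc i) * B)))"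
    by (simp add: mult_ac del: of_nat_Suc)
  hence "c (Suc n) * (of_nat (Suc n) * A) = - (c n * (of_nat (Suc i) * B))"
    by (subst (asm) mult_left_cancel) simp_all
  hence rec: "c n * (of_nat (Suc i) * B) = - (c (Suc n) * (of_nat (Suc n) * A))"
    by (simp only: minus_minus)
  have "Suc i * (L choose Suc i) = Suc n * (L choose i)"
    using binomial_absorb_comp[of L i] binomial_absorption[of i L] n by (simp del: of_nat_Suc)
  hence choose: "of_nat (Suc i) * of_nat (L choose Suc i) = (of_nat (Suc n) * of_nat (L choose i) :: complex)"
    by (metis of_nat_mult)
  have IH: "(-1) ^ i * c (Suc n) = of_nat (L choose i) * X"
    using Suc.IH Suc.prems n by (simp add: c_def X_def L_def del: of_nat_Suc)
  have "((-1) ^ Suc i * c n) * (of_nat (Suc i) * B) = ((-1) ^ i * c (Suc n)) * (of_nat (Suc n) * A)"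
    using rec by (simp add: mult.assoc del: of_nat_Suc)
  also have "\<dots> = (of_nat (Suc n) * of_nat (L choose i)) * X * A"
    unfolding IH by (simp only: mult_ac)
  also have "\<dots> = (of_nat (L choose Suc i) * (X * (A / B))) * (of_nat (Suc i) * B)"
    unfolding choose[symmetric] using Bnz by (simp add: field_simps del: of_nat_Suc)
  finally have "(-1) ^ Suc i * c n = of_nat (L choose Suc i) * (X * (A / B))"
    using Bnz by (subst (asm) mult_right_cancel) (simp_all del: of_nat_Suc)
  thus ?case
    by (simp only: c_def n_def L_def X_def A_def B_def prod.lessThan_Suc prod_dividef
        times_divide_times_eq)
qed

end

section \<open>Consistent parameters\<close>

lemma lx_Suc_le:
  assumes "consistent r m l k" "s \<le> r"
  shows "lx r l k (Suc s) \<le> lx r l k s"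
  using assms by (cases "s = r") (auto simp: consistent_def lx_def)

text \<open>
  The degrees are the orders at \<open>0\<close> increased by \<open>l\<^bsub>r-i\<^esub> -
  l\<^bsub>r-i+1\<^esub>\<close>. The two inequalities that make the parameters consistent are \<open>a\<^sub>i
  \<le> d\<^sub>i\<close> and \<open>d\<^sub>i < a\<^sub>i\<^sub>+\<^sub>1\<close>, and the lengths \<open>d\<^sub>i
  - a\<^sub>i\<close> telescope to \<open>k\<close>.
\<close>

lemma U_eq_block_space:
  fixes r k :: nat and m l :: "nat \<Rightarrow> nat"
  assumes cons: "consistent r m l k"
  defines "a \<equiv> exponent0 r m"
  defines "d \<equiv> \<lambda>i. exponent0 r m i + (lx r l k (r - i) - lx r l k (Suc (r - i)))"
  shows "interlacing a d r"
    and "U r m l k = interlacing.block_space a d r"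
proof -
  have lx_le: "lx r l k (Suc s) \<le> lx r l k s" if "s \<le> r" for s
    using lx_Suc_le[OF cons that] .
  show I: "interlacing a d r"
  proof
    fix i assume "i < r"
    define s where "s = r - i"
    have s: "s \<in> {1..r}" using \<open>i < r\<close> by (auto simp: s_def)
    have "{r + 1 - Suc i..r} = insert s {r + 1 - i..r}" "s \<notin> {r + 1 - i..r}"
      using \<open>i < r\<close> by (auto simp: s_def)
    hence "a (Suc i) = Suc (a i + m s)" by (simp add: a_def exponent0_def)
    moreover have "int (lx r l k s) - int (lx r l k (Suc s)) \<le> int (m s)"
      using cons s unfolding consistent_def by (metis Suc_eq_plus1)
    hence "lx r l k s - lx r l k (Suc s) \<le> m s" by linarith
    ultimately show "d i < a (Suc i)" by (simp add: d_def a_def s_def)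
  qed (simp add: a_def d_def)
  interpret interlacing a d r by (fact I)
  have dual: "int (d i) = dual_exponent r m l k i" if "i \<le> r" for i
    using lx_le[of "r - i"] by (simp add: d_def dual_exponent_def exponent0_def of_nat_diff)
  have "excess = (\<Sum>i\<le>r. lx r l k (r - i) - lx r l k (Suc (r - i)))"
    unfolding excess_def by (simp add: a_def d_def)
  also have "\<dots> = (\<Sum>s\<le>r. lx r l k s - lx r l k (Suc s))"
    by (rule sum.reindex_bij_witness[of _ "\<lambda>s. r - s" "\<lambda>s. r - s"]) auto
  also have "int \<dots> = (\<Sum>s\<le>r. int (lx r l k s) - int (lx r l k (Suc s)))"
    unfolding of_nat_sum by (intro sum.cong refl of_nat_diff lx_le) simp
  also have "\<dots> = int k"
    by (subst sum_telescope) (simp add: lx_def)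
  finally have ex: "excess = k" by simp
  have degs: "{int (degree p) | p. p \<in> V \<and> p \<noteq> 0} = {dual_exponent r m l k i | i. i \<le> r} \<longleftrightarrow>
      {degree p | p. p \<in> V \<and> p \<noteq> 0} = d ` {..r}" for V
  proof -
    have "{int (degree p) | p. p \<in> V \<and> p \<noteq> 0} = int ` {degree p | p. p \<in> V \<and> p \<noteq> 0}" by auto
    moreover have "{dual_exponent r m l k i | i. i \<le> r} = int ` (d ` {..r})"
      using dual by (auto simp: image_iff)
    ultimately show ?thesis by (simp only: inj_image_eq_iff[OF inj_of_nat])
  qed
  have ords: "{exponent0 r m i | i. i \<le> r} = a ` {..r}" by (auto simp: a_def)
  have "is_U r m l k V \<longleftrightarrow> V = block_space" for V
  proof
    assume "is_U r m l k V"
    thus "V = block_space"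
      unfolding is_U_def degs ords by (intro block_space_unique) (simp_all add: ex)
  next
    assume V: "V = block_space"
    show "is_U r m l k V"
      unfolding is_U_def degs ords V degrees_block_space orders_0_block_space orders_1_block_space
        dim_block_space ex by simp
  qed
  thus "U r m l k = block_space" by (simp add: U_def)
qed

theorem proposition5p6:
  fixes r k :: nat and m l :: "nat \<Rightarrow> nat"
  assumes "r \<ge> 1" and "consistent r m l k"
  shows "u0 r m l k = (\<Sum>i=0..lx r l k r. monom ((-1) ^ i * u0_coeff r m l k i) (lx r l k r - i)) \<and>
    (\<forall>i\<le>lx r l k r.
      u0_coeff r m l k i =
        of_nat (lx r l k r choose i) *
        (\<Prod>j<i. \<Prod>s=1..r.
          ((\<Sum>t=r-s+1..r. of_nat (m t)) - of_nat (lx r l k r) + of_nat s + of_nat j) /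
          ((\<Sum>t=r-s+1..r. of_nat (m t)) - of_nat (lx r l k r) + of_nat s + of_nat j + 1
             + of_nat (lx r l k (r - s)) - of_nat (lx r l k (r - s + 1)))))"
proof -
  define L where "L = lx r l k r"
  define a where "a = exponent0 r m"
  define d where "d = (\<lambda>i. exponent0 r m i + (lx r l k (r - i) - lx r l k (Suc (r - i))))"
  note basis = U_eq_block_space[OF assms(2), folded a_def d_def]
  interpret interlacing a d r by (fact basis(1))
  have a0: "a 0 = 0" by (simp add: a_def exponent0_def)
  have d0: "d 0 = L" by (simp add: d_def exponent0_def L_def lx_def)
  define u where "u = smult (node_weight nodes (d 0)) (block_poly 0)"
  have u0: "u0 r m l k = u"
    unfolding u0_def basis(2) L_def[symmetric] d0[symmetric] monic_lowest_degree u_def by simp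
  have deg: "degree u = L" using monic_lowest_degree[of u] by (simp add: u_def d0)
  have c: "u0_coeff r m l k i = (-1) ^ i * coeff u (L - i)" for i
    by (simp add: u0_coeff_def u0 L_def)
  have "u = (\<Sum>n\<le>L. monom (coeff u n) n)" using poly_as_sum_of_monoms[of u] deg by simp
  also have "\<dots> = (\<Sum>i=0..L. monom (coeff u (L - i)) (L - i))"
    by (rule sum.reindex_bij_witness[of _ "\<lambda>i. L - i" "\<lambda>i. L - i"]) auto
  also have "\<dots> = (\<Sum>i=0..L. monom ((-1) ^ i * u0_coeff r m l k i) (L - i))"
    by (simp add: c)
  finally have expansion: "u = (\<Sum>i=0..L. monom ((-1) ^ i * u0_coeff r m l k i) (L - i))" .
  have num: "of_nat (a s) - of_nat L + of_nat j
      = (\<Sum>t=r-s+1..r. of_nat (m t)) - of_nat L + of_nat s + (of_nat j :: complex)"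
    if "s \<in> {1..r}" for s j
    using that by (simp add: a_def exponent0_def Suc_diff_le)
  have den: "of_nat (d s) - of_nat L + of_nat j + 1
      = (\<Sum>t=r-s+1..r. of_nat (m t)) - of_nat L + of_nat s + (of_nat j :: complex) + 1
          + of_nat (lx r l k (r - s)) - of_nat (lx r l k (r - s + 1))"
    if "s \<in> {1..r}" for s j
    using that lx_Suc_le[OF assms(2), of "r - s"]
    by (simp add: d_def exponent0_def Suc_diff_le of_nat_diff)
  have formula: "u0_coeff r m l k i =
        of_nat (L choose i) *
        (\<Prod>j<i. \<Prod>s=1..r.
          ((\<Sum>t=r-s+1..r. of_nat (m t)) - of_nat L + of_nat s + of_nat j) /
          ((\<Sum>t=r-s+1..r. of_nat (m t)) - of_nat L + of_nat s + of_nat j + 1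
             + of_nat (lx r l k (r - s)) - of_nat (lx r l k (r - s + 1))))" if "i \<le> L" for i
  proof -
    have "u0_coeff r m l k i = of_nat (L choose i) * (\<Prod>j<i. \<Prod>s=1..r.
        (of_nat (a s) - of_nat L + of_nat j) / (of_nat (d s) - of_nat L + of_nat j + 1))"
      using lowest_coeff_formula[OF a0] that unfolding c u_def d0 by blast
    also have "(\<Prod>j<i. \<Prod>s=1..r.
        (of_nat (a s) - of_nat L + of_nat j) / (of_nat (d s) - of_nat L + of_nat j + 1)) =
      (\<Prod>j<i. \<Prod>s=1..r.
          ((\<Sum>t=r-s+1..r. of_nat (m t)) - of_nat L + of_nat s + of_nat j) /
          ((\<Sum>t=r-s+1..r. of_nat (m t)) - of_nat L + of_nat s + of_nat j + 1
             + of_nat (lx r l k (r - s)) - (of_nat (lx r l k (r - s + 1)) :: complex)))"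
      by (intro prod.cong refl arg_cong2[of _ _ _ _ "(/)"] num den)
    finally show ?thesis .
  qed
  show ?thesis using expansion formula unfolding u0 L_def by blast
qed

end
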